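(* Let $[60]=\{1,2,\dots,60\}$. For $i=1,\dots,10$ let $G_i=\{6(i-1)+1,\,6(i-1)+2,\,\dots,\,6i\}$, and write $G_i^{(1)}=\{6(i-1)+1,6(i-1)+2,6(i-1)+3\}$ and $G_i^{(2)}=\{6(i-1)+4,6(i-1)+5,6i\}$. Let $\mathcal{B}$ be the family of $30$ six-element subsets of $[60]$ consisting of the ten sets $G_1,\dots,G_{10}$ together with the twenty sets $G_{2m-1}^{(u)}\cup G_{2m}^{(v)}$ for $m\in\{1,2,3,4,5\}$ and $u,v\in\{1,2\}$. Then for every $S\subset[60]$ with $|S|=6$ there exists $B\in\mathcal{B}$ such that $|S\cap B|\ge 2$. Equivalently, every $6$-subset $S$ of $[60]$ contains a pair $\{x,y\}\subset S$ that is contained in at least one block $B\in\mathcal{B}$. *)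

theory Defs
  imports Main
begin

definition G :: "nat \<Rightarrow> nat set" where
  "G i = {6 * (i - 1) + 1 .. 6 * i}"

(* The half of G i with superscript u: the value u = 1 is the lower half and u = 2 the upper
   half. Both definitions are only meant for i >= 1 (truncated subtraction on nat). *)
definition G_half :: "nat \<Rightarrow> nat \<Rightarrow> nat set" where
  "G_half i u =
    (if u = 1 then {6 * (i - 1) + 1, 6 * (i - 1) + 2, 6 * (i - 1) + 3}
     else {6 * (i - 1) + 4, 6 * (i - 1) + 5, 6 * i})"

definition blocks :: "nat set set" where
  "blocks = {G i | i. i \<in> {1..10}} \<union>
    {G_half (2 * m - 1) u \<union> G_half (2 * m) v | m u v. m \<in> {1..5} \<and> u \<in> {1, 2} \<and> v \<in> {1, 2}}"

end

(*
  The pairs G (2 * m - 1), G (2 * m) split the 60 points into five classes of 12 points each. Two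
  points of a class always share a block: G i if both lie in the same G i, and otherwise the union
  of the two halves that contain them. By the pigeonhole principle, two of six points lie in the
  same class. The 30 blocks are distinct because a block is determined by its least and greatest
  elements.
*)
theory Submission
  imports Defs
begin

text \<open>A single function on triples, so that the mixed blocks become an image of
  \<open>half_params\<close> and can be counted by injectivity.\<close>

definition half_union :: "nat \<times> nat \<times> nat \<Rightarrow> nat set" where
  "half_union = (\<lambda>(m, u, v). G_half (2 * m - 1) u \<union> G_half (2 * m) v)"

definition half_params :: "(nat \<times> nat \<times> nat) set" where
  "half_params = {1..5} \<times> {1, 2} \<times> {1, 2}"

lemma blocks_eq: "blocks = G ` {1..10} \<union> half_union ` half_params"
  unfolding blocks_def half_union_def half_params_def image_def Bex_def split_paired_Ex mem_Times_iff
    fst_conv snd_conv case_prod_conv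
  by blast

lemma G_half_eq_interval:
  assumes "i \<ge> 1" "u \<in> {1, 2}"
  shows "G_half i u = {6 * (i - 1) + 3 * (u - 1) + 1..6 * (i - 1) + 3 * u}"
  using assms unfolding G_half_def by auto

text \<open>Both halves are measured from \<open>12 * (m - 1)\<close>, the number of points before
  class \<open>m\<close>; the second half is shifted by the 6 points of
  \<open>G (2 * m - 1)\<close>. Extrema and cardinality then become linear arithmetic.\<close>

lemma half_union_eq_intervals:
  assumes "(m, u, v) \<in> half_params"
  shows "half_union (m, u, v) =
    {12 * (m - 1) + 3 * (u - 1) + 1..12 * (m - 1) + 3 * u} \<union>
    {12 * (m - 1) + 3 * (v - 1) + 7..12 * (m - 1) + 3 * v + 6}"
proof -
  have m: "m \<ge> 1" and uv: "u \<in> {1, 2}" "v \<in> {1, 2}"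
    using assms by (auto simp: half_params_def)
  have "6 * (2 * m - 1 - 1) = 12 * (m - 1)" "6 * (2 * m - 1) = 12 * (m - 1) + 6"
    using m by auto
  then show ?thesis
    using m uv by (simp add: half_union_def G_half_eq_interval add.commute add.left_commute)
qed

lemma Min_G: "i \<ge> 1 \<Longrightarrow> Min (G i) = 6 * (i - 1) + 1"
  and Max_G: "i \<ge> 1 \<Longrightarrow> Max (G i) = 6 * i"
  unfolding G_def by (auto intro!: Min_eqI Max_eqI)

lemma Min_half_union:
  "(m, u, v) \<in> half_params \<Longrightarrow> Min (half_union (m, u, v)) = 12 * (m - 1) + 3 * (u - 1) + 1"
  by (rule Min_eqI) (auto simp: half_union_eq_intervals half_params_def)

lemma Max_half_union:
  "(m, u, v) \<in> half_params \<Longrightarrow> Max (half_union (m, u, v)) = 12 * (m - 1) + 3 * v + 6"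
  by (rule Max_eqI) (auto simp: half_union_eq_intervals half_params_def)

lemma inj_on_G: "inj_on G {1..10}"
  by (rule inj_onI) (metis Max_G atLeastAtMost_iff mult_cancel1 zero_neq_numeral)

lemma inj_on_half_union: "inj_on half_union half_params"
proof (rule inj_onI, unfold split_paired_all)
  fix m u v m' u' v'
  assume h: "(m, u, v) \<in> half_params" "(m', u', v') \<in> half_params"
    and eq: "half_union (m, u, v) = half_union (m', u', v')"
  have "12 * (m - 1) + 3 * (u - 1) + 1 = 12 * (m' - 1) + 3 * (u' - 1) + 1"
    using eq h by (metis Min_half_union)
  moreover have "12 * (m - 1) + 3 * v + 6 = 12 * (m' - 1) + 3 * v' + 6"
    using eq h by (metis Max_half_union)
  moreover have "1 \<le> m" "1 \<le> m'" "1 \<le> u" "u \<le> 2" "1 \<le> u'" "u' \<le> 2"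
    using h by (auto simp: half_params_def)
  \<comment> \<open>The minima differ by 12 times the difference of \<open>m\<close> and
    \<open>m'\<close>, up to a term from \<open>u\<close> and \<open>u'\<close> of size at most 3.
    With \<open>m = m'\<close>, the minima give \<open>u = u'\<close> and the maxima
    \<open>v = v'\<close>.\<close>
  moreover from calculation have "m = m'" by linarith
  ultimately show "(m, u, v) = (m', u', v')" by simp
qed

text \<open>Modulo 6, equal minima force \<open>u = 1\<close> and hence
  \<open>i = 2 * m - 1\<close>, while equal maxima force \<open>v = 2\<close> and hence
  \<open>i = 2 * m\<close>.\<close>

lemma G_neq_half_union:
  assumes i: "i \<in> {1..10}" and p: "(m, u, v) \<in> half_params"
  shows "G i \<noteq> half_union (m, u, v)"
proof
  assume eq: "G i = half_union (m, u, v)"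
  have "6 * (i - 1) + 1 = 12 * (m - 1) + 3 * (u - 1) + 1"
    using eq i p by (metis Min_half_union Min_G atLeastAtMost_iff)
  moreover have "6 * i = 12 * (m - 1) + 3 * v + 6"
    using eq i p by (metis Max_half_union Max_G atLeastAtMost_iff)
  moreover have "1 \<le> i" "1 \<le> m" "u \<in> {1, 2}" "v \<in> {1, 2}"
    using i p by (auto simp: half_params_def)
  ultimately show False by auto presburger+
qed

lemma card_blocks: "card blocks = 30"
proof -
  have "G ` {1..10} \<inter> half_union ` half_params = {}"
    using G_neq_half_union by fast
  moreover have "finite half_params" "card half_params = 20"
    by (simp_all add: half_params_def)
  ultimately show ?thesis
    using card_image[OF inj_on_G] card_image[OF inj_on_half_union]
    by (simp add: blocks_eq card_Un_disjoint)
qed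

lemma block_subset_card:
  assumes "B \<in> blocks"
  shows "B \<subseteq> {1..60} \<and> card B = 6"
  using assms unfolding blocks_eq
proof
  assume "B \<in> G ` {1..10}"
  then show ?thesis by (auto simp: G_def)
next
  assume "B \<in> half_union ` half_params"
  then obtain m u v where p: "(m, u, v) \<in> half_params" and B: "B = half_union (m, u, v)"
    by auto
  have b: "1 \<le> m" "m \<le> 5" "1 \<le> u" "u \<le> 2" "1 \<le> v" "v \<le> 2"
    using p by (auto simp: half_params_def)
  \<comment> \<open>The first interval ends at \<open>12 * (m - 1) + 6\<close> or earlier, the
    second starts at \<open>12 * (m - 1) + 7\<close> or later, and each has 3 points.\<close>
  have "card B = card {12 * (m - 1) + 3 * (u - 1) + 1..12 * (m - 1) + 3 * u} +
      card {12 * (m - 1) + 3 * (v - 1) + 7..12 * (m - 1) + 3 * v + 6}"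
    unfolding B half_union_eq_intervals[OF p] by (rule card_Un_disjoint) (use b in auto)
  then have "card B = 6" using b by simp
  moreover have "B \<subseteq> {1..60}"
    unfolding B half_union_eq_intervals[OF p] using b by auto
  ultimately show ?thesis by simp
qed

lemma G_cover:
  assumes "x \<ge> 1"
  shows "x \<in> G ((x - 1) div 6 + 1)"
  using assms unfolding G_def by simp presburger

lemma G_split:
  assumes "i \<ge> 1" "x \<in> G i"
  shows "\<exists>u\<in>{1, 2}. x \<in> G_half i u"
  using assms unfolding G_def G_half_def by auto

lemma same_class_imp_common_block:
  assumes x: "x \<in> {1..60}" and y: "y \<in> {1..60}" and c: "(x - 1) div 12 = (y - 1) div 12"
  shows "\<exists>B\<in>blocks. {x, y} \<subseteq> B"
proof -
  \<comment> \<open>The claim is symmetric in the two points; ordering them puts \<open>x\<close>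
    into the first group of the class whenever the groups differ.\<close>
  have ordered: "\<exists>B\<in>blocks. {x, y} \<subseteq> B"
    if x: "x \<in> {1..60}" and y: "y \<in> {1..60}"
      and c: "(x - 1) div 12 = (y - 1) div 12" and le: "x \<le> y" for x y
  proof -
    define i where "i = (x - 1) div 6 + 1"
    define j where "j = (y - 1) div 6 + 1"
    define m where "m = (x - 1) div 12 + 1"
    have xi: "x \<in> G i" and yj: "y \<in> G j"
      using G_cover x y by (auto simp: i_def j_def)
    have i: "i \<in> {1..10}" and m: "m \<in> {1..5}"
      using x by (auto simp: i_def m_def)
    show ?thesis
    proof (cases "i = j")
      case True
      then show ?thesis using xi yj i by (auto simp: blocks_eq)
    next
      case False
      have div12: "n div 12 = n div 6 div 2" for n :: nat
        using div_mult2_eq[of n 6 2] by simp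
      have "(x - 1) div 6 \<le> (y - 1) div 6"
        using le by (intro div_le_mono diff_le_mono)
      \<comment> \<open>By \<open>div12\<close>, \<open>i - 1\<close> and \<open>j - 1\<close> both
        have quotient \<open>m - 1\<close> on division by 2. As \<open>i < j\<close>, their
        remainders are 0 and 1.\<close>
      then have ij: "i = 2 * m - 1 \<and> j = 2 * m"
        using False c unfolding i_def j_def m_def div12 by simp linarith
      have "i \<ge> 1" "j \<ge> 1"
        by (simp_all add: i_def j_def)
      then obtain u v where uv: "u \<in> {1, 2}" "v \<in> {1, 2}"
          and "x \<in> G_half i u" "y \<in> G_half j v"
        using G_split xi yj by meson
      then have "{x, y} \<subseteq> half_union (m, u, v)"
        by (simp add: half_union_def ij)
      moreover have "(m, u, v) \<in> half_params"
        unfolding half_params_def using m uv by blast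
      ultimately show ?thesis
        unfolding blocks_eq by blast
    qed
  qed
  show ?thesis
    using ordered[OF x y c] ordered[OF y x c[symmetric]] by (metis insert_commute nat_le_linear)
qed

lemma pair_in_block:
  assumes S: "S \<subseteq> {1..60}" "card S = 6"
  shows "\<exists>x y. x \<noteq> y \<and> {x, y} \<subseteq> S \<and> (\<exists>B\<in>blocks. {x, y} \<subseteq> B)"
proof -
  \<comment> \<open>Points start at 1, so \<open>x - 1\<close> is at most 59, which is below
    \<open>5 * 12\<close>: six points, five class numbers.\<close>
  have "(\<lambda>x. (x - 1) div 12) ` S \<subseteq> {..<5}"
    using S(1) by (fastforce simp: less_mult_imp_div_less)
  then have "card ((\<lambda>x. (x - 1) div 12) ` S) \<le> card {..<5::nat}"
    by (rule card_mono[OF finite_lessThan])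
  then have "card ((\<lambda>x. (x - 1) div 12) ` S) < card S"
    using S(2) by simp
  then have "\<not> inj_on (\<lambda>x. (x - 1) div 12) S"
    by (rule pigeonhole)
  then obtain x y where xy: "x \<in> S" "y \<in> S" "x \<noteq> y"
      and c: "(x - 1) div 12 = (y - 1) div 12"
    unfolding inj_on_def by blast
  have "\<exists>B\<in>blocks. {x, y} \<subseteq> B"
    using same_class_imp_common_block[OF _ _ c] xy S(1) by blast
  then show ?thesis
    using xy by blast
qed

theorem theorem1:
  shows "card blocks = 30 \<and> (\<forall>B\<in>blocks. B \<subseteq> {1..60} \<and> card B = 6) \<and>
    (\<forall>S. S \<subseteq> {1..60::nat} \<and> card S = 6 \<longrightarrow> (\<exists>B\<in>blocks. card (S \<inter> B) \<ge> 2)) \<and>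
    (\<forall>S. S \<subseteq> {1..60::nat} \<and> card S = 6 \<longrightarrow>
      (\<exists>x y. x \<noteq> y \<and> {x, y} \<subseteq> S \<and> (\<exists>B\<in>blocks. {x, y} \<subseteq> B)))"
proof (intro conjI allI impI)
  fix S :: "nat set"
  assume S: "S \<subseteq> {1..60} \<and> card S = 6"
  then obtain x y B where "x \<noteq> y" "{x, y} \<subseteq> S" "B \<in> blocks" "{x, y} \<subseteq> B"
    using pair_in_block by meson
  \<comment> \<open>Needed for monotonicity of \<open>card\<close>, which is 0 on infinite
    sets.\<close>
  moreover have "finite (S \<inter> B)"
    using S finite_subset by blast
  ultimately have "card {x, y} \<le> card (S \<inter> B)"
    by (intro card_mono) auto
  then show "\<exists>B\<in>blocks. card (S \<inter> B) \<ge> 2"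
    using \<open>x \<noteq> y\<close> \<open>B \<in> blocks\<close> by (auto simp: numeral_2_eq_2)
qed (use card_blocks block_subset_card pair_in_block in blast)+

end
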